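(* Let $D$ be an integral domain with quotient field $K$ and let $\star$ be a semistar operation on $D$. If $D$ is a P$\star$MD, then the map $T \mapsto \mathrm{Na}(T,t_T)$ from the set of $(\star,t_T)$-linked overrings $T$ of $D$ to the set of overrings of $\mathrm{Na}(D,\star)$ is a bijection, with inverse map $\mathcal{T} \mapsto \mathcal{T}\cap K$. In particular, if $R$ is a P$v$MD with quotient field $K$, then the map $T \mapsto \mathrm{Na}(T,t_T)$ from the set of $t$-linked overrings $T$ of $R$ to the set of overrings of $\mathrm{Na}(R,t_R)$ is a bijection, with inverse map $\mathcal{T}\mapsto \mathcal{T}\cap K$.
   Context: Let $D$ be an integral domain with quotient field $K$. Denote by $\overline{\boldsymbol F}(D)$ the set of nonzero $D$-submodules of $K$ and by $\boldsymbol f(D)$ the set of nonzero finitely generated $D$-submodules of $K$. An overring of a domain is a ring between the domain and its quotient field (both included). A semistar operation on $D$ is a map $\star:\overline{\boldsymbol F}(D)\to\overline{\boldsymbol F}(D)$, $E\mapsto E^\star$, such that for all $0\ne x\in K$ and $E,F\in\overline{\boldsymbol F}(D)$: $(xE)^\star=xE^\star$; $E\subseteq F$ implies $E^\star\subseteq F^\star$; $E\subseteq E^\star$ and $(E^\star)^\star=E^\star$. The associated finite-type operation is $E^{\star_f}:=\bigcup\{F^\star\mid F\in\boldsymbol f(D),\,F\subseteq E\}$. P$\star$MD: $D$ is a P$\star$MD (Prüfer $\star$-multiplication domain) if $(FF^{-1})^{\star_f}=D^{\star}$ for every $F\in\boldsymbol f(D)$, where $F^{-1}=(D:_KF)$.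 For a domain $T$, $v_T$ is the operation $E^{v_T}=(T:(T:E))$ (colons taken in the quotient field of $T$) and $t_T:=(v_T)_f$. A P$v$MD is a domain $R$ that is a P$v_R$MD. Nagata ring: for a polynomial $g$, $\boldsymbol c(g)$ denotes its content, i.e. the ideal generated by its coefficients. With $X$ an indeterminate, $\mathrm{Na}(D,\star):=\{f/g\mid f,g\in D[X],\ g\neq0,\ \boldsymbol c(g)^\star=D^\star\}$; its quotient field is $K(X)$. Linkedness: if $T$ is an overring of $D$ and $\star,\star'$ are semistar operations on $D,T$ respectively, then $T$ is $(\star,\star')$-linked to $D$ if, for every nonzero finitely generated integral ideal $F$ of $D$, $F^\star=D^\star$ implies $(FT)^{\star'}=T^{\star'}$. A $t$-linked overring $T$ of $R$ is one that is $(t_R,t_T)$-linked to $R$. *)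

theory Defs
  imports "HOL-Computational_Algebra.Polynomial_Factorial"
begin

text \<open>
  Domains are represented as unital subrings of a field type \<open>'a\<close>, which plays the role of the
  quotient field \<open>K\<close>; the condition that it is the quotient field is \<open>quot_field D = UNIV\<close>.
  The field \<open>K(X)\<close> is the type \<open>'a poly fract\<close>.
\<close>

definition is_subring :: "'a::comm_ring_1 set \<Rightarrow> bool" where
  "is_subring D \<longleftrightarrow> 1 \<in> D \<and> (\<forall>x\<in>D. \<forall>y\<in>D. x - y \<in> D \<and> x * y \<in> D)"

definition quot_field :: "'a::field set \<Rightarrow> 'a set" where
  "quot_field D = {a / b | a b. a \<in> D \<and> b \<in> D \<and> b \<noteq> 0}"

definition overring :: "'a::field set \<Rightarrow> 'a set \<Rightarrow> bool" where
  "overring D T \<longleftrightarrow> is_subring T \<and> D \<subseteq> T \<and> T \<subseteq> quot_field D"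

definition submodule :: "'a::field set \<Rightarrow> 'a set \<Rightarrow> bool" where
  "submodule D E \<longleftrightarrow>
     0 \<in> E \<and> (\<forall>x\<in>E. \<forall>y\<in>E. x + y \<in> E) \<and> (\<forall>r\<in>D. \<forall>x\<in>E. r * x \<in> E)"

definition Fbar :: "'a::field set \<Rightarrow> 'a set set" where
  "Fbar D = {E. submodule D E \<and> E \<noteq> {0}}"

definition fg :: "'a::field set \<Rightarrow> 'a set set" where
  "fg D = {E \<in> Fbar D. \<exists>S. finite S \<and> E = submodule D hull S}"

definition mod_prod :: "'a::field set \<Rightarrow> 'a set \<Rightarrow> 'a set" where
  "mod_prod E F = {\<Sum>i<n. a i * b i | (n::nat) a b. \<forall>i<n. a i \<in> E \<and> b i \<in> F}"

text \<open>\<open>colon E F\<close> is \<open>(E :\<^sub>K F)\<close>.\<close>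

definition colon :: "'a::field set \<Rightarrow> 'a set \<Rightarrow> 'a set" where
  "colon E F = {x. \<forall>y\<in>F. x * y \<in> E}"

text \<open>
  Operations are total functions on sets; only their values on \<open>Fbar D\<close> are constrained
  here, and only those values are used below.
\<close>

definition semistar :: "'a::field set \<Rightarrow> ('a set \<Rightarrow> 'a set) \<Rightarrow> bool" where
  "semistar D star \<longleftrightarrow>
     (\<forall>E\<in>Fbar D. star E \<in> Fbar D) \<and>
     (\<forall>x. \<forall>E\<in>Fbar D. x \<noteq> 0 \<longrightarrow> star ((*) x ` E) = (*) x ` star E) \<and>
     (\<forall>E\<in>Fbar D. \<forall>F\<in>Fbar D. E \<subseteq> F \<longrightarrow> star E \<subseteq> star F) \<and>
     (\<forall>E\<in>Fbar D. E \<subseteq> star E \<and> star (star E) = star E)"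

definition fin_type :: "'a::field set \<Rightarrow> ('a set \<Rightarrow> 'a set) \<Rightarrow> 'a set \<Rightarrow> 'a set" where
  "fin_type D star E = \<Union> {star F | F. F \<in> fg D \<and> F \<subseteq> E}"

definition PsMD :: "'a::field set \<Rightarrow> ('a set \<Rightarrow> 'a set) \<Rightarrow> bool" where
  "PsMD D star \<longleftrightarrow>
     (\<forall>F\<in>fg D. fin_type D star (mod_prod F (colon D F)) = star D)"

definition v_op :: "'a::field set \<Rightarrow> 'a set \<Rightarrow> 'a set" where
  "v_op T E = colon T (colon T E)"

definition t_op :: "'a::field set \<Rightarrow> 'a set \<Rightarrow> 'a set" where
  "t_op T = fin_type T (v_op T)"

definition PvMD :: "'a::field set \<Rightarrow> bool" where
  "PvMD R \<longleftrightarrow> PsMD R (v_op R)"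

definition polys_over :: "'a::field set \<Rightarrow> 'a poly set" where
  "polys_over D = {p. \<forall>i. coeff p i \<in> D}"

definition content_ideal :: "'a::field set \<Rightarrow> 'a poly \<Rightarrow> 'a set" where
  "content_ideal D g = submodule D hull (range (coeff g))"

definition Na :: "'a::field set \<Rightarrow> ('a set \<Rightarrow> 'a set) \<Rightarrow> 'a poly fract set" where
  "Na D star = {to_fract f / to_fract g | f g.
     f \<in> polys_over D \<and> g \<in> polys_over D \<and> g \<noteq> 0 \<and> star (content_ideal D g) = star D}"

text \<open>\<open>cap_K \<T>\<close> is \<open>\<T> \<inter> K\<close>, with \<open>K\<close> identified with the constants in \<open>K(X)\<close>.\<close>

definition cap_K :: "'a::field poly fract set \<Rightarrow> 'a set" where
  "cap_K \<T> = {a. to_fract [:a:] \<in> \<T>}"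

definition linked ::
  "'a::field set \<Rightarrow> ('a set \<Rightarrow> 'a set) \<Rightarrow> 'a set \<Rightarrow> ('a set \<Rightarrow> 'a set) \<Rightarrow> bool" where
  "linked D star T star' \<longleftrightarrow>
     (\<forall>F\<in>fg D. F \<subseteq> D \<longrightarrow> star F = star D \<longrightarrow> star' (mod_prod F T) = star' T)"

definition bij_with_inverse :: "('a \<Rightarrow> 'b) \<Rightarrow> ('b \<Rightarrow> 'a) \<Rightarrow> 'a set \<Rightarrow> 'b set \<Rightarrow> bool" where
  "bij_with_inverse f g A B \<longleftrightarrow>
     bij_betw f A B \<and> g ` B \<subseteq> A \<and> (\<forall>x\<in>A. g (f x) = x) \<and> (\<forall>y\<in>B. f (g y) = y)"

end

theory Submission
  imports Defs
begin

text \<open>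
  For a subring \<open>T\<close> of \<open>K\<close>, a nonzero \<open>g \<in> T[X]\<close> satisfies \<open>c(g)\<^sup>t = T\<close> iff \<open>x c(g) \<subseteq> T\<close> forces
  \<open>x \<in> T\<close>. For such \<open>g\<close> Gauss' lemma holds: \<open>gh \<in> T[X]\<close> implies \<open>h \<in> T[X]\<close>. Hence \<open>Na(T, t\<^sub>T)\<close> is a
  ring that meets \<open>K\<close> in \<open>T\<close>. If \<open>D\<close> is a P\<open>\<star>\<close>MD, then every nonzero \<open>f \<in> K[X]\<close> has a partner
  \<open>q\<close> with coefficients in \<open>(D : c(f))\<close> such that \<open>fq \<in> D[X]\<close> and \<open>c(fq)\<^sup>\<star> = D\<^sup>\<star>\<close>; so \<open>fq\<close> is a unit
  of \<open>Na(D, \<star>)\<close>. Let \<open>\<T>\<close> be an overring of \<open>Na(D, \<star>)\<close> and \<open>T = \<T> \<inter> K\<close>. The partner of the denominator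
  makes every fraction of \<open>Na(T, t\<^sub>T)\<close> an element of \<open>\<T>\<close>. Conversely, after passing to a unit
  denominator in \<open>D[X]\<close>, an element of \<open>\<T>\<close> has its numerator \<open>h\<close> in \<open>\<T> \<inter> K[X]\<close>, and the
  coefficients of \<open>h\<close> are \<open>h \<cdot> (h\<^sub>i p) / (hp) \<in> \<T>\<close> for the partner \<open>p\<close> of \<open>h\<close>.
\<close>

section \<open>Subrings and submodules\<close>

lemma
  assumes "is_subring T"
  shows subring_0: "0 \<in> T" and subring_1: "1 \<in> T"
    and subring_diff: "x \<in> T \<Longrightarrow> y \<in> T \<Longrightarrow> x - y \<in> T"
    and subring_add: "x \<in> T \<Longrightarrow> y \<in> T \<Longrightarrow> x + y \<in> T"
    and subring_mult: "x \<in> T \<Longrightarrow> y \<in> T \<Longrightarrow> x * y \<in> T"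
proof -
  show diff: "x - y \<in> T" if "x \<in> T" "y \<in> T" for x y
    using assms that by (auto simp: is_subring_def)
  show one: "1 \<in> T"
    using assms by (auto simp: is_subring_def)
  show zero: "0 \<in> T"
    using diff[OF one one] by simp
  have uminus: "- x \<in> T" if "x \<in> T" for x
    using diff[OF zero that] by simp
  show "x + y \<in> T" if "x \<in> T" "y \<in> T" for x y
    using diff[OF that(1) uminus[OF that(2)]] by simp
  show "x * y \<in> T" if "x \<in> T" "y \<in> T" for x y
    using assms that by (auto simp: is_subring_def)
qed

lemma subring_sum:
  assumes "is_subring T" "\<And>i. i \<in> A \<Longrightarrow> f i \<in> T"
  shows "(\<Sum>i\<in>A. f i) \<in> T"
  using assms(2)
  by (induction A rule: infinite_finite_induct)
     (auto intro: subring_0 subring_add assms(1))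

lemma submodule_sum:
  assumes "submodule D E" "\<And>i. i \<in> A \<Longrightarrow> f i \<in> E"
  shows "(\<Sum>i\<in>A. f i) \<in> E"
  using assms(2)
  by (induction A rule: infinite_finite_induct)
     (use assms(1) in \<open>auto simp: submodule_def\<close>)

lemma submodule_self: "is_subring T \<Longrightarrow> submodule T T"
  by (auto simp: submodule_def intro: subring_0 subring_add subring_mult)

lemma submodule_hull: "submodule D (submodule D hull S)"
  by (rule hull_in) (auto simp: submodule_def)

lemma submodule_colon:
  assumes "submodule D E"
  shows "submodule D (colon E F)"
  using assms by (auto simp: submodule_def colon_def distrib_right mult.assoc)

text \<open>Together with \<open>content_ideal_minimal\<close>, it reduces a claim about a whole
  content ideal times \<open>c\<close> to one about each coefficient times \<open>c\<close>.\<close>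

lemma submodule_scale: "submodule D E \<Longrightarrow> submodule D {x. x * c \<in> E}"
  by (auto simp: submodule_def distrib_right mult.assoc)

lemma Fbar_self: "is_subring T \<Longrightarrow> T \<in> Fbar T"
  using submodule_self[of T] subring_1[of T] by (auto simp: Fbar_def)

text \<open>Scalars are absorbed by the second factors, which lie in \<open>T\<close>; so
  \<open>F\<close> may be any set, in particular a module over a smaller ring.\<close>

lemma submodule_mod_prod:
  assumes "is_subring T"
  shows "submodule T (mod_prod F T)"
  unfolding submodule_def
proof (intro conjI ballI)
  show "0 \<in> mod_prod F T"
    by (auto simp: mod_prod_def intro!: exI[of _ 0])
next
  fix x y
  assume "x \<in> mod_prod F T" "y \<in> mod_prod F T"
  then obtain n a b m c d where
    x: "x = (\<Sum>i<(n::nat). a i * b i)" "\<forall>i<n. a i \<in> F \<and> b i \<in> T" and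
    y: "y = (\<Sum>i<(m::nat). c i * d i)" "\<forall>i<m. c i \<in> F \<and> d i \<in> T"
    unfolding mod_prod_def by blast
  \<comment> \<open>Concatenation of the two representations: indices from \<open>n\<close> on run
    through the one of \<open>y\<close>.\<close>
  define a' where "a' i = (if i < n then a i else c (i - n))" for i
  define b' where "b' i = (if i < n then b i else d (i - n))" for i
  have "(\<Sum>i<n+k. a' i * b' i) = x + (\<Sum>i<k. c i * d i)" for k
    by (induction k) (simp_all add: x(1) a'_def b'_def algebra_simps)
  hence "x + y = (\<Sum>i<n+m. a' i * b' i)"
    using y(1) by simp
  moreover have "\<forall>i<n+m. a' i \<in> F \<and> b' i \<in> T"
    using x(2) y(2) by (auto simp: a'_def b'_def)
  ultimately show "x + y \<in> mod_prod F T"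
    unfolding mod_prod_def by blast
next
  fix r x
  assume r: "r \<in> T" and "x \<in> mod_prod F T"
  then obtain n a b where
    x: "x = (\<Sum>i<(n::nat). a i * b i)" "\<forall>i<n. a i \<in> F \<and> b i \<in> T"
    unfolding mod_prod_def by blast
  have "r * x = (\<Sum>i<n. a i * (r * b i))"
    unfolding x(1) sum_distrib_left by (simp add: algebra_simps)
  moreover have "\<forall>i<n. a i \<in> F \<and> r * b i \<in> T"
    using x(2) subring_mult[OF assms r] by auto
  ultimately show "r * x \<in> mod_prod F T"
    unfolding mod_prod_def by (intro CollectI exI[of _ n] exI[of _ a] exI[of _ "\<lambda>i. r * b i"]) auto
qed

section \<open>Polynomials over a subring\<close>

lemma polys_over_coeff: "p \<in> polys_over T \<Longrightarrow> coeff p i \<in> T"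
  by (simp add: polys_over_def)

lemma polys_over_mono: "D \<subseteq> T \<Longrightarrow> polys_over D \<subseteq> polys_over T"
  by (auto simp: polys_over_def)

lemma
  assumes "is_subring T"
  shows polys_over_diff: "p \<in> polys_over T \<Longrightarrow> q \<in> polys_over T \<Longrightarrow> p - q \<in> polys_over T"
    and polys_over_add: "p \<in> polys_over T \<Longrightarrow> q \<in> polys_over T \<Longrightarrow> p + q \<in> polys_over T"
    and polys_over_mult: "p \<in> polys_over T \<Longrightarrow> q \<in> polys_over T \<Longrightarrow> p * q \<in> polys_over T"
    and polys_over_smult: "c \<in> T \<Longrightarrow> p \<in> polys_over T \<Longrightarrow> smult c p \<in> polys_over T"
    and polys_over_monom: "c \<in> T \<Longrightarrow> monom c n \<in> polys_over T"
    and polys_over_const: "c \<in> T \<Longrightarrow> [:c:] \<in> polys_over T"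
    and polys_over_1: "1 \<in> polys_over T"
  by (auto simp: polys_over_def coeff_mult coeff_pCons split: nat.split
        intro!: subring_diff[OF assms] subring_add[OF assms] subring_mult[OF assms]
          subring_sum[OF assms] subring_0[OF assms] subring_1[OF assms])

lemma content_ideal_coeff: "coeff g i \<in> content_ideal D g"
  unfolding content_ideal_def by (rule hull_inc) auto

lemma content_ideal_minimal:
  "submodule D E \<Longrightarrow> (\<And>i. coeff g i \<in> E) \<Longrightarrow> content_ideal D g \<subseteq> E"
  unfolding content_ideal_def by (rule hull_minimal) auto

lemma submodule_content_ideal: "submodule D (content_ideal D g)"
  unfolding content_ideal_def by (rule submodule_hull)

lemma finite_range_coeff: "finite (range (coeff p))"
proof (rule finite_subset)
  show "range (coeff p) \<subseteq> insert 0 (coeff p ` {..degree p})"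
    using coeff_eq_0[of p] by (force simp: not_le[symmetric])
qed simp

lemma content_ideal_fg: "g \<noteq> 0 \<Longrightarrow> content_ideal D g \<in> fg D"
  using finite_range_coeff[of g] submodule_content_ideal[of D g] content_ideal_coeff[of g _ D]
  unfolding fg_def Fbar_def
  by (auto simp: content_ideal_def poly_eq_iff)

lemma content_ideal_1: "is_subring T \<Longrightarrow> content_ideal T 1 = T"
proof
  assume T: "is_subring T"
  show "content_ideal T 1 \<subseteq> T"
    by (intro content_ideal_minimal submodule_self polys_over_coeff polys_over_1 T)
  have "1 \<in> content_ideal T 1"
    using content_ideal_coeff[of 1 0 T] by simp
  then show "T \<subseteq> content_ideal T 1"
    using submodule_content_ideal[of T 1] by (force simp: submodule_def)
qed

text \<open>The exponents of \<open>q\<close> are spaced so widely that no two products of coefficients of \<open>f\<close>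
  and \<open>q\<close> meet in the same degree of \<open>f * q\<close>; so \<open>c(fq) = c(f)c(q)\<close> for this \<open>q\<close>.\<close>

lemma interlaced_poly:
  fixes f :: "'a::field poly"
  assumes "finite B"
  shows "\<exists>q. (\<forall>j. coeff q j \<in> insert 0 B) \<and> (\<forall>b\<in>B. \<forall>i. \<exists>k. coeff (f * q) k = b * coeff f i)"
  using assms
proof induction
  case empty
  show ?case by (rule exI[of _ 0]) auto
next
  case (insert b B)
  then obtain q where q: "\<forall>j. coeff q j \<in> insert 0 B"
    "\<forall>b\<in>B. \<forall>i. \<exists>k. coeff (f * q) k = b * coeff f i" by blast
  \<comment> \<open>\<open>N\<close> exceeds the degree of \<open>f\<close>, so
    \<open>smult b f\<close> lives below degree \<open>N\<close> and the shifted old product from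
    \<open>N\<close> on.\<close>
  define N where "N = Suc (degree f)"
  define q' where "q' = [:b:] + monom 1 N * q"
  have "f * q' = smult b f + monom 1 N * (f * q)"
    by (simp add: q'_def algebra_simps)
  hence fq': "coeff (f * q') k = (if k < N then b * coeff f k else coeff (f * q) (k - N))" for k
    by (simp add: coeff_monom_mult coeff_eq_0 N_def)
  have "coeff q' j \<in> insert 0 (insert b B)" for j
    using q(1) by (auto simp: q'_def coeff_monom_mult coeff_pCons N_def split: nat.split)
  moreover have "\<exists>k. coeff (f * q') k = c * coeff f i" if c: "c \<in> insert b B" for c i
  proof (cases "c = b")
    case True
    show ?thesis
    proof (cases "i < N")
      case True
      then show ?thesis using \<open>c = b\<close> fq'[of i] by auto
    next
      case False
      then have "c * coeff f i = 0"
        by (simp add: N_def coeff_eq_0)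
      \<comment> \<open>Some coefficient has to realise the value 0; the one just past the degree
        does.\<close>
      moreover have "coeff (f * q') (Suc (degree (f * q'))) = 0"
        by (rule coeff_eq_0) simp
      ultimately show ?thesis by metis
    qed
  next
    case False
    then obtain k where "coeff (f * q) k = c * coeff f i"
      using c q(2) by blast
    then show ?thesis
      using fq'[of "k + N"] by auto
  qed
  ultimately show ?case by blast
qed

text \<open>The case \<open>f = 1\<close> of \<open>interlaced_poly\<close> makes the finitely many
  generators coefficients of one polynomial; the padding zeros add nothing to the hull. This turns
  linkedness, a statement about ideals, into one about contents.\<close>

lemma ex_poly_content:
  assumes "F \<in> fg D"
  obtains g where "g \<noteq> 0" "content_ideal D g = F"
proof -
  obtain S where S: "finite S" "F = submodule D hull S" and F: "F \<in> Fbar D"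
    using assms by (auto simp: fg_def)
  obtain g where g: "\<forall>j. coeff g j \<in> insert 0 S" "\<forall>b\<in>S. \<forall>i. \<exists>k. coeff g k = b * coeff 1 i"
    using interlaced_poly[OF S(1), of 1] by auto
  have "content_ideal D g = F"
  proof
    show "content_ideal D g \<subseteq> F"
    proof (rule content_ideal_minimal)
      show "submodule D F" using F by (simp add: Fbar_def)
      show "coeff g i \<in> F" for i
        using g(1)[rule_format, of i] hull_inc[of _ S "submodule D"] \<open>submodule D F\<close>
        unfolding S(2)[symmetric] submodule_def by (cases "coeff g i = 0") auto
    qed
    have "b \<in> range (coeff g)" if "b \<in> S" for b
      using g(2)[rule_format, OF that, of 0] by auto
    then show "F \<subseteq> content_ideal D g"
      unfolding S(2) content_ideal_def by (intro hull_mono) auto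
  qed
  moreover have "g \<noteq> 0"
  proof
    assume "g = 0"
    then have "F \<subseteq> {0}"
      unfolding \<open>content_ideal D g = F\<close>[symmetric]
      by (intro content_ideal_minimal) (auto simp: submodule_def)
    with F show False by (auto simp: Fbar_def submodule_def)
  qed
  ultimately show ?thesis by (rule that[rotated])
qed

lemma clear_denominators:
  assumes D: "is_subring D" and K: "quot_field D = UNIV"
  shows "\<exists>d. d \<in> D \<and> d \<noteq> 0 \<and> smult d f \<in> polys_over D"
proof (induction f)
  case 0
  show ?case
    using subring_1[OF D] subring_0[OF D] by (intro exI[of _ 1]) (auto simp: polys_over_def)
next
  case (pCons a p)
  then obtain d where d: "d \<in> D" "d \<noteq> 0" "smult d p \<in> polys_over D" by blast
  have "a \<in> quot_field D" using K by simp
  then obtain b c where bc: "b \<in> D" "c \<in> D" "c \<noteq> 0" "a = b / c"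
    by (auto simp: quot_field_def)
  have "c * (d * coeff p i) \<in> D" for i
    using subring_mult[OF D bc(2)] polys_over_coeff[OF d(3)] by simp
  moreover have "c * (d * a) \<in> D"
    using subring_mult[OF D d(1) bc(1)] bc by simp
  ultimately have "smult (c * d) (pCons a p) \<in> polys_over D"
    by (auto simp: polys_over_def coeff_pCons mult.assoc split: nat.split)
  then show ?case
    using d bc subring_mult[OF D] by (intro exI[of _ "c * d"]) auto
qed

section \<open>Primitive polynomials and Gauss' lemma\<close>

text \<open>For nonzero \<open>g \<in> T[X]\<close> this says that \<open>(T : c(g)) = T\<close>, i.e. \<open>c(g)\<^sup>t = T\<close>.\<close>

definition primitive_over :: "'a::field set \<Rightarrow> 'a poly \<Rightarrow> bool" where
  "primitive_over T g \<longleftrightarrow>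
     g \<in> polys_over T \<and> g \<noteq> 0 \<and> (\<forall>x. smult x g \<in> polys_over T \<longrightarrow> x \<in> T)"

text \<open>The argument of McCoy's theorem on zero divisors, applied to multiplication by \<open>g\<close> on
  \<open>(K/T)[X]\<close>: an element of least degree annihilated by \<open>g\<close> is annihilated by each of the
  coefficients of \<open>g\<close>.\<close>

lemma gauss_primitive:
  assumes T: "is_subring T" and g: "primitive_over T g" and "g * h \<in> polys_over T"
  shows "h \<in> polys_over T"
  using assms(3)
proof (induction "degree h" arbitrary: h rule: less_induct)
  case less
  define k where "k = degree h"
  have gT: "g \<in> polys_over T"
    using g by (simp add: primitive_over_def)
  \<comment> \<open>Subtracting the monomial of degree \<open>k\<close> lowers the degree, so the
    outer induction hypothesis applies to the rest.\<close>
  have top: "p \<in> polys_over T"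
    if p: "degree p \<le> k" "g * p \<in> polys_over T" "coeff p k \<in> T" for p
  proof -
    define m where "m = monom (coeff p k) k"
    have m: "m \<in> polys_over T"
      unfolding m_def by (rule polys_over_monom[OF T p(3)])
    \<comment> \<open>The zero polynomial is treated apart because for \<open>k = 0\<close> its
      degree is not smaller.\<close>
    have "p - m \<in> polys_over T"
    proof (cases "p - m = 0")
      case True
      then show ?thesis using subring_0[OF T] by (simp add: polys_over_def)
    next
      case False
      have "degree (p - m) \<le> k"
        using p(1) by (auto simp: m_def intro!: degree_diff_le degree_monom_le)
      moreover have "coeff (p - m) k = 0"
        by (simp add: m_def)
      ultimately have "degree (p - m) < k"
        using False by (metis le_neq_implies_less leading_coeff_0_iff)
      moreover have "g * (p - m) \<in> polys_over T"
        unfolding right_diff_distrib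
        by (rule polys_over_diff[OF T p(2) polys_over_mult[OF T gT m]])
      ultimately show ?thesis
        using less.hyps by (simp add: k_def)
    qed
    from polys_over_add[OF T this m] show ?thesis by simp
  qed
  \<comment> \<open>Downward induction on \<open>i\<close>. In the coefficient of
    \<open>g * h\<close> at \<open>i + k\<close>, terms with \<open>j < i\<close> vanish because
    \<open>h\<close> has degree \<open>k\<close>, and those with \<open>j > i\<close> lie in
    \<open>T\<close> by induction. Hence so does \<open>coeff g i * coeff h k\<close>, and
    \<open>top\<close> applies to \<open>smult (coeff g i) h\<close>.\<close>
  have ann: "smult (coeff g i) h \<in> polys_over T" for i
  proof (induction "degree g - i" arbitrary: i rule: less_induct)
    case (less i)
    show ?case
    proof (cases "i \<le> degree g")
      case False
      then show ?thesis
        using subring_0[OF T] by (simp add: coeff_eq_0 polys_over_def)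
    next
      case True
      have other: "coeff g j * coeff h (i + k - j) \<in> T" if "j \<noteq> i" for j
      proof (cases "j < i")
        case True
        then show ?thesis
          using subring_0[OF T] by (simp add: coeff_eq_0 k_def)
      next
        case False
        \<comment> \<open>For \<open>j\<close> above \<open>degree g\<close> truncated subtraction
          need not decrease, but there the coefficient of \<open>g\<close> is 0.\<close>
        then have "degree g - j < degree g - i \<or> degree g < j"
          using that \<open>i \<le> degree g\<close> by linarith
        then have "smult (coeff g j) h \<in> polys_over T"
          using less.hyps[of j] subring_0[OF T] by (auto simp: coeff_eq_0 polys_over_def)
        from polys_over_coeff[OF this, of "i + k - j"] show ?thesis by simp
      qed
      have "coeff (g * h) (i + k) =
          coeff g i * coeff h k + (\<Sum>j\<in>{..i + k} - {i}. coeff g j * coeff h (i + k - j))"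
        unfolding coeff_mult by (subst sum.remove[of _ i]) auto
      moreover have "coeff (g * h) (i + k) \<in> T"
        using less.prems \<open>g * h \<in> polys_over T\<close> by (intro polys_over_coeff)
      moreover have "(\<Sum>j\<in>{..i + k} - {i}. coeff g j * coeff h (i + k - j)) \<in> T"
        by (rule subring_sum[OF T], rule other) auto
      ultimately have "coeff g i * coeff h k \<in> T"
        by (metis add_diff_cancel_right' subring_diff[OF T])
      moreover have "g * smult (coeff g i) h \<in> polys_over T"
        using polys_over_smult[OF T polys_over_coeff[OF gT] \<open>g * h \<in> polys_over T\<close>] by simp
      ultimately show ?thesis
        using top[of "smult (coeff g i) h"] by (simp add: k_def)
    qed
  qed
  \<comment> \<open>Read for all \<open>i\<close> at once, this says that \<open>coeff h k\<close>
    multiplies \<open>g\<close> into \<open>T[X]\<close>, so primitivity applies.\<close>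
  have "coeff g i * coeff h k \<in> T" for i
    using polys_over_coeff[OF ann[of i], of k] by simp
  then have "smult (coeff h k) g \<in> polys_over T"
    by (simp add: polys_over_def mult.commute)
  then have "coeff h k \<in> T"
    using g by (simp add: primitive_over_def)
  then show ?case
    using less.prems top[of h] by (simp add: k_def)
qed

text \<open>Gauss' lemma strips \<open>g\<close> from \<open>smult x (g * h)\<close>, and
  primitivity of \<open>h\<close> finishes. Closure of \<open>Na T (t_op T)\<close> under
  differences and products rests on this.\<close>

lemma primitive_over_mult:
  assumes T: "is_subring T" and g: "primitive_over T g" and h: "primitive_over T h"
  shows "primitive_over T (g * h)"
  unfolding primitive_over_def
proof (intro conjI allI impI)
  show "g * h \<in> polys_over T" "g * h \<noteq> 0"
    using g h polys_over_mult[OF T] by (auto simp: primitive_over_def)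
  fix x
  assume "smult x (g * h) \<in> polys_over T"
  then have "smult x h \<in> polys_over T"
    using gauss_primitive[OF T g, of "smult x h"] by simp
  then show "x \<in> T"
    using h by (simp add: primitive_over_def)
qed

lemma primitive_over_1: "is_subring T \<Longrightarrow> primitive_over T 1"
  unfolding primitive_over_def polys_over_def
  by (auto simp: subring_0 subring_1 dest: spec[of _ 0])

section \<open>The operations v and t\<close>

lemma colon_antimono: "E \<subseteq> F \<Longrightarrow> colon T F \<subseteq> colon T E"
  by (auto simp: colon_def)

lemma v_op_incl: "E \<subseteq> v_op T E"
  by (auto simp: v_op_def colon_def mult.commute)

text \<open>The colon reverses inclusions and every set lies in its double colon, so a triple colon
  is a single one.\<close>

lemma v_op_idem: "v_op T (v_op T E) = v_op T E"
proof -
  have "colon T (v_op T E) = colon T E"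
    using colon_antimono[OF v_op_incl[of E T]] v_op_incl[of "colon T E" T]
    by (auto simp: v_op_def)
  then show ?thesis by (simp add: v_op_def)
qed

lemma v_op_mono: "E \<subseteq> F \<Longrightarrow> v_op T E \<subseteq> v_op T F"
  unfolding v_op_def by (intro colon_antimono)

lemma colon_self: "is_subring T \<Longrightarrow> colon T T = T"
  using subring_mult[of T] subring_1[of T] by (force simp: colon_def)

lemma v_op_self: "is_subring T \<Longrightarrow> v_op T T = T"
  by (simp add: v_op_def colon_self)

text \<open>This makes the statement on PvMDs an instance of the general one.\<close>

lemma v_op_semistar:
  assumes D: "is_subring D"
  shows "semistar D (v_op D)"
  unfolding semistar_def
proof (intro conjI ballI allI impI)
  fix E assume "E \<in> Fbar D"
  then have E: "submodule D E" "E \<noteq> {0}" by (auto simp: Fbar_def)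
  show incl: "E \<subseteq> v_op D E"
    by (rule v_op_incl)
  show "v_op D (v_op D E) = v_op D E"
    by (rule v_op_idem)
  obtain e where "e \<in> E" "e \<noteq> 0"
    using E by (auto simp: submodule_def)
  with incl have "v_op D E \<noteq> {0}" by auto
  then show "v_op D E \<in> Fbar D"
    by (auto simp: Fbar_def v_op_def intro!: submodule_colon submodule_self D)
next
  fix x :: 'a and E assume x: "x \<noteq> 0"
  have image: "(*) x ` A = {y. y / x \<in> A}" for A
  proof safe
    fix y assume "y / x \<in> A"
    then show "y \<in> (*) x ` A"
      using x by (intro image_eqI[of _ _ "y / x"]) auto
  qed (use x in auto)
  \<comment> \<open>The inner colon turns scaling by \<open>x\<close> into division by
    \<open>x\<close>, and the outer colon turns it back.\<close>
  have scale: "colon D ((*) c ` A) = {y. y * c \<in> colon D A}" for c A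
    by (auto simp: colon_def mult.assoc)
  have "colon D {y. y * x \<in> A} = {y. y / x \<in> colon D A}" for A
  proof safe
    fix y assume y: "y \<in> colon D {y. y * x \<in> A}"
    show "y / x \<in> colon D A"
      unfolding colon_def
    proof safe
      fix a assume "a \<in> A"
      then have "a / x * x \<in> A" using x by simp
      then have "y * (a / x) \<in> D" using y unfolding colon_def by blast
      then show "y / x * a \<in> D" by (simp add: field_simps)
    qed
  next
    fix y assume y: "y / x \<in> colon D A"
    show "y \<in> colon D {y. y * x \<in> A}"
      unfolding colon_def
    proof safe
      fix z assume "z * x \<in> A"
      then have "y / x * (z * x) \<in> D" using y unfolding colon_def by blast
      then show "y * z \<in> D" using x by (simp add: field_simps)
    qed
  qed
  then show "v_op D ((*) x ` E) = (*) x ` v_op D E"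
    unfolding v_op_def scale unfolding image by (simp only:)
next
  fix E F :: "'a set" assume "E \<subseteq> F"
  then show "v_op D E \<subseteq> v_op D F" by (rule v_op_mono)
qed

text \<open>\<open>E\<close> is itself one of the modules in the union, and by monotonicity it gives
  the largest term.\<close>

lemma t_op_fg: "E \<in> fg T \<Longrightarrow> t_op T E = v_op T E"
  unfolding t_op_def fin_type_def using v_op_mono[of _ E T] by blast

lemma t_op_self:
  assumes "is_subring T"
  shows "t_op T T = T"
  using t_op_fg[OF content_ideal_fg[of 1 T]] content_ideal_1[OF assms] v_op_self[OF assms]
  by simp

text \<open>The \<open>x\<close> that multiply \<open>g\<close> into \<open>T[X]\<close> form
  \<open>(T : c(g))\<close>, which contains \<open>T\<close>. If the double colon is
  \<open>T\<close>, it contains 1, which forces the single colon into \<open>T\<close>; the converse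
  is \<open>colon_self\<close>.\<close>

lemma t_op_content_eq_iff_primitive:
  assumes T: "is_subring T" and g: "g \<in> polys_over T" "g \<noteq> 0"
  shows "t_op T (content_ideal T g) = t_op T T \<longleftrightarrow> primitive_over T g"
proof -
  have mem: "x \<in> colon T (content_ideal T g) \<longleftrightarrow> smult x g \<in> polys_over T" for x
  proof
    assume "x \<in> colon T (content_ideal T g)"
    then show "smult x g \<in> polys_over T"
      by (auto simp: colon_def polys_over_def content_ideal_coeff)
  next
    assume "smult x g \<in> polys_over T"
    then have "content_ideal T g \<subseteq> {y. y * x \<in> T}"
      by (intro content_ideal_minimal submodule_scale submodule_self T)
         (auto simp: polys_over_def mult.commute)
    then show "x \<in> colon T (content_ideal T g)"
      by (auto simp: colon_def mult.commute)
  qed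
  have sub: "T \<subseteq> colon T (content_ideal T g)"
    using mem polys_over_smult[OF T _ g(1)] by blast
  have "colon T (colon T (content_ideal T g)) = T \<longleftrightarrow> colon T (content_ideal T g) \<subseteq> T"
  proof
    assume "colon T (colon T (content_ideal T g)) = T"
    with subring_1[OF T] have "1 \<in> colon T (colon T (content_ideal T g))" by simp
    then show "colon T (content_ideal T g) \<subseteq> T" by (auto simp: colon_def)
  next
    assume "colon T (content_ideal T g) \<subseteq> T"
    with sub have "colon T (content_ideal T g) = T" by blast
    then show "colon T (colon T (content_ideal T g)) = T"
      by (metis colon_self[OF T])
  qed
  then show ?thesis
    using g mem unfolding t_op_fg[OF content_ideal_fg[OF g(2)]] t_op_self[OF T] v_op_def
    by (auto simp: primitive_over_def)
qed


section \<open>The Nagata ring\<close>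

lemma Na_t_op:
  assumes T: "is_subring T"
  shows "Na T (t_op T) =
    {to_fract f / to_fract g | f g. f \<in> polys_over T \<and> primitive_over T g}"
  unfolding Na_def using t_op_content_eq_iff_primitive[OF T]
  by (auto simp: primitive_over_def) blast

lemma Na_t_op_subring:
  assumes T: "is_subring T"
  shows "is_subring (Na T (t_op T))"
  unfolding is_subring_def
proof (intro conjI ballI)
  have "(1 :: 'a poly fract) = to_fract 1 / to_fract 1" by simp
  then show "1 \<in> Na T (t_op T)"
    unfolding Na_t_op[OF T] using polys_over_1[OF T] primitive_over_1[OF T] by blast
next
  fix x y assume "x \<in> Na T (t_op T)" "y \<in> Na T (t_op T)"
  then obtain f g f' g' where
    f: "f \<in> polys_over T" "primitive_over T g" "x = to_fract f / to_fract g" and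
    f': "f' \<in> polys_over T" "primitive_over T g'" "y = to_fract f' / to_fract g'"
    unfolding Na_t_op[OF T] by blast
  have gg': "primitive_over T (g * g')"
    by (rule primitive_over_mult[OF T f(2) f'(2)])
  have nz: "g \<noteq> 0" "g' \<noteq> 0" "g \<in> polys_over T" "g' \<in> polys_over T"
    using f(2) f'(2) by (auto simp: primitive_over_def)
  have "x - y = to_fract (f * g' - f' * g) / to_fract (g * g')"
    using nz by (simp add: f(3) f'(3) field_simps)
  moreover have "f * g' - f' * g \<in> polys_over T"
    using f(1) f'(1) nz by (intro polys_over_diff polys_over_mult T)
  ultimately show "x - y \<in> Na T (t_op T)"
    unfolding Na_t_op[OF T] using gg' by blast
  have "x * y = to_fract (f * f') / to_fract (g * g')"
    by (simp add: f(3) f'(3))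
  moreover have "f * f' \<in> polys_over T"
    by (rule polys_over_mult[OF T f(1) f'(1)])
  ultimately show "x * y \<in> Na T (t_op T)"
    unfolding Na_t_op[OF T] using gg' by blast
qed

text \<open>If a constant \<open>a\<close> equals \<open>f / g\<close>, then
  \<open>smult a g = f\<close> is over \<open>T\<close>, which is just what primitivity of
  \<open>g\<close> tests.\<close>

lemma cap_K_Na_t_op:
  assumes T: "is_subring T"
  shows "cap_K (Na T (t_op T)) = T"
proof (intro equalityI subsetI)
  fix a assume "a \<in> cap_K (Na T (t_op T))"
  then obtain f g where fg: "f \<in> polys_over T" "primitive_over T g"
    "to_fract [:a:] = to_fract f / to_fract g"
    unfolding cap_K_def Na_t_op[OF T] by blast
  then have "to_fract g * to_fract [:a:] = to_fract f"
    by (simp add: primitive_over_def field_simps)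
  then have "g * [:a:] = f"
    unfolding to_fract_mult[symmetric] to_fract_eq_iff .
  then have "smult a g = f" by simp
  then show "a \<in> T"
    using fg by (auto simp: primitive_over_def)
next
  fix a assume "a \<in> T"
  moreover have "to_fract [:a:] = to_fract [:a:] / to_fract 1" by simp
  ultimately show "a \<in> cap_K (Na T (t_op T))"
    unfolding cap_K_def Na_t_op[OF T]
    using polys_over_const[OF T] primitive_over_1[OF T] by blast
qed

lemma polys_over_subset_Na:
  assumes D: "is_subring D"
  shows "to_fract ` polys_over D \<subseteq> Na D star"
proof safe
  fix f assume "f \<in> polys_over D"
  moreover have "to_fract f = to_fract f / to_fract 1" by simp
  ultimately show "to_fract f \<in> Na D star"
    unfolding Na_def using polys_over_1[OF D] content_ideal_1[OF D] by fastforce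
qed

lemma quot_field_Na:
  assumes D: "is_subring D" and K: "quot_field D = UNIV"
  shows "quot_field (Na D star) = UNIV"
proof -
  have "x \<in> quot_field (Na D star)" for x
  proof -
    obtain f g where x: "x = to_fract f / to_fract g" "g \<noteq> 0"
      by (cases x) (auto simp: Fract_conv_to_fract)
    obtain d where d: "d \<in> D" "d \<noteq> 0" "smult d f \<in> polys_over D"
      using clear_denominators[OF assms] by blast
    obtain e where e: "e \<in> D" "e \<noteq> 0" "smult e g \<in> polys_over D"
      using clear_denominators[OF assms] by blast
    \<comment> \<open>Numerator and denominator are both scaled by \<open>d\<close> and
      \<open>e\<close>, which preserves the quotient.\<close>
    define a where "a = smult e (smult d f)"
    define b where "b = smult d (smult e g)"
    have b0: "b \<noteq> 0"
      using d e x by (simp add: b_def)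
    have "to_fract f * to_fract b = to_fract a * to_fract g"
      unfolding to_fract_mult[symmetric] to_fract_eq_iff a_def b_def by (simp add: mult.commute)
    then have "x = to_fract a / to_fract b"
      using b0 x by (simp add: frac_eq_eq)
    moreover have "a \<in> polys_over D" "b \<in> polys_over D"
      using d e polys_over_smult[OF D] unfolding a_def b_def by blast+
    then have "to_fract a \<in> Na D star" "to_fract b \<in> Na D star"
      using polys_over_subset_Na[OF D] by blast+
    moreover have "to_fract b \<noteq> 0"
      using b0 by simp
    ultimately show ?thesis
      unfolding quot_field_def by blast
  qed
  then show ?thesis by blast
qed

section \<open>Extension: from linked overrings of \<open>D\<close> to overrings of the Nagata
  ring\<close>

lemma mod_prod_content_ideal:
  assumes T: "is_subring T" and DT: "D \<subseteq> T"
  shows "mod_prod (content_ideal D g) T = content_ideal T g"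
proof
  have "submodule D (content_ideal T g)"
    using submodule_content_ideal[of T g] DT by (auto simp: submodule_def)
  then have "content_ideal D g \<subseteq> content_ideal T g"
    by (rule content_ideal_minimal) (rule content_ideal_coeff)
  then have "a * b \<in> content_ideal T g" if "a \<in> content_ideal D g" "b \<in> T" for a b
    using that submodule_content_ideal[of T g] by (auto simp: submodule_def mult.commute[of a])
  then show "mod_prod (content_ideal D g) T \<subseteq> content_ideal T g"
    by (auto simp: mod_prod_def intro!: submodule_sum submodule_content_ideal)
  show "content_ideal T g \<subseteq> mod_prod (content_ideal D g) T"
  proof (rule content_ideal_minimal[OF submodule_mod_prod[OF T]])
    fix i
    show "coeff g i \<in> mod_prod (content_ideal D g) T"
      unfolding mod_prod_def using content_ideal_coeff[of g i D] subring_1[OF T]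
      by (intro CollectI exI[of _ "Suc 0"] exI[of _ "\<lambda>_. coeff g i"] exI[of _ "\<lambda>_. 1"]) auto
  qed
qed

text \<open>Linkedness is applied to the content ideal of \<open>g\<close> over \<open>D\<close>,
  whose extension to \<open>T\<close> is the content ideal over \<open>T\<close>. Thus denominators
  of \<open>Na D star\<close> are denominators of \<open>Na T (t_op T)\<close>.\<close>

lemma linked_primitive:
  assumes T: "is_subring T" and DT: "D \<subseteq> T" and D: "is_subring D"
    and linked: "linked D star T (t_op T)"
    and g: "g \<in> polys_over D" "g \<noteq> 0" "star (content_ideal D g) = star D"
  shows "primitive_over T g"
proof -
  have "content_ideal D g \<subseteq> D"
    using g(1) by (intro content_ideal_minimal submodule_self D polys_over_coeff)
  then have "t_op T (mod_prod (content_ideal D g) T) = t_op T T"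
    using linked g content_ideal_fg[OF g(2)] unfolding linked_def by blast
  then show ?thesis
    using g polys_over_mono[OF DT]
    unfolding mod_prod_content_ideal[OF T DT]
    by (subst t_op_content_eq_iff_primitive[symmetric, OF T]) auto
qed

lemma Na_t_op_overring:
  assumes D: "is_subring D" and K: "quot_field D = UNIV"
    and T: "overring D T" and linked: "linked D star T (t_op T)"
  shows "overring (Na D star) (Na T (t_op T))"
proof -
  have T': "is_subring T" "D \<subseteq> T"
    using T by (auto simp: overring_def)
  have "Na D star \<subseteq> Na T (t_op T)"
  proof
    fix x assume "x \<in> Na D star"
    then obtain f g where fg: "f \<in> polys_over D" "x = to_fract f / to_fract g"
      "g \<in> polys_over D" "g \<noteq> 0" "star (content_ideal D g) = star D"
      unfolding Na_def by blast
    have "primitive_over T g"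
      by (rule linked_primitive[OF T' D linked fg(3-5)])
    then show "x \<in> Na T (t_op T)"
      unfolding Na_t_op[OF T'(1)] using fg(1,2) polys_over_mono[OF T'(2)] by blast
  qed
  then show ?thesis
    unfolding overring_def quot_field_Na[OF D K]
    using Na_t_op_subring[OF T'(1)] by simp
qed

text \<open>By the PsMD property, 1 lies in \<open>star H\<close> for some finitely generated
  \<open>H\<close> inside the product of \<open>c(f)\<close> and its inverse. The finitely many
  inverse factors used to write the generators of \<open>H\<close> become the coefficients of
  \<open>q\<close>, spaced so that \<open>c(fq)\<close> contains \<open>H\<close>.\<close>

lemma PsMD_inverse_content:
  assumes D: "is_subring D" and star: "semistar D star" and P: "PsMD D star"
    and f: "f \<noteq> 0"
  obtains q where "\<And>i. coeff q i \<in> colon D (content_ideal D f)"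
    "f * q \<in> polys_over D" "f * q \<noteq> 0" "star (content_ideal D (f * q)) = star D"
proof -
  define F where "F = content_ideal D f"
  define G where "G = colon D F"
  have G: "submodule D G"
    unfolding G_def by (intro submodule_colon submodule_self D)
  have "D \<in> Fbar D" by (rule Fbar_self[OF D])
  have "1 \<in> star D"
    using star \<open>D \<in> Fbar D\<close> subring_1[OF D] by (auto simp: semistar_def)
  also have "star D = fin_type D star (mod_prod F G)"
    using P content_ideal_fg[OF f] by (simp add: PsMD_def F_def G_def)
  finally obtain H where H: "1 \<in> star H" "H \<in> fg D" "H \<subseteq> mod_prod F G"
    unfolding fin_type_def by blast
  obtain S where S: "finite S" "H = submodule D hull S"
    using H(2) by (auto simp: fg_def)
  have "\<forall>s\<in>S. \<exists>n a b. s = (\<Sum>i<(n::nat). a i * b i) \<and> (\<forall>i<n. a i \<in> F \<and> b i \<in> G)"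
    using H(3) hull_subset[of S "submodule D"] unfolding S(2) mod_prod_def by blast
  then obtain n a b where sum: "\<And>s. s \<in> S \<Longrightarrow> s = (\<Sum>i<(n s::nat). a s i * b s i)"
    and ab: "\<And>s i. s \<in> S \<Longrightarrow> i < n s \<Longrightarrow> a s i \<in> F \<and> b s i \<in> G"
    by metis
  define B where "B = (\<Union>s\<in>S. b s ` {..<n s})"
  have B: "finite B" "B \<subseteq> G"
    using S(1) ab by (auto simp: B_def)
  obtain q where q: "\<forall>j. coeff q j \<in> insert 0 B"
    "\<forall>b\<in>B. \<forall>i. \<exists>k. coeff (f * q) k = b * coeff f i"
    using interlaced_poly[OF B(1), of f] by blast
  define E where "E = content_ideal D (f * q)"
  have E: "submodule D E"
    unfolding E_def by (rule submodule_content_ideal)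
  have qG: "coeff q i \<in> G" for i
    using q(1)[rule_format, of i] B(2) G by (cases "coeff q i = 0") (auto simp: submodule_def)
  have "coeff q j * coeff f i \<in> D" for i j
    using qG[of j] content_ideal_coeff[of f i D] by (auto simp: G_def colon_def F_def)
  then have fq: "f * q \<in> polys_over D"
    by (auto simp: polys_over_def coeff_mult mult.commute intro!: subring_sum[OF D])
  then have ED: "E \<subseteq> D"
    unfolding E_def by (intro content_ideal_minimal submodule_self D polys_over_coeff)
  have "H \<subseteq> E"
    unfolding S(2)
  proof (intro hull_minimal E subsetI)
    fix s assume s: "s \<in> S"
    \<comment> \<open>Spacing puts each coefficient of \<open>f\<close> times \<open>c\<close> into
      \<open>E\<close>; hence all of \<open>F\<close> times \<open>c\<close> lies there.\<close>
    have "F \<subseteq> {x. x * c \<in> E}" if c: "c \<in> B" for c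
      unfolding F_def
    proof (intro content_ideal_minimal submodule_scale E CollectI)
      fix i
      obtain k where "coeff (f * q) k = c * coeff f i"
        using q(2) c by blast
      then show "coeff f i * c \<in> E"
        unfolding E_def by (metis content_ideal_coeff mult.commute)
    qed
    then have "a s i * b s i \<in> E" if "i < n s" for i
      using ab[OF s that] s that by (auto simp: B_def)
    then show "s \<in> E"
      by (subst sum[OF s]) (auto intro!: submodule_sum[OF E])
  qed
  \<comment> \<open>The semistar axioms concern nonzero modules only; \<open>E\<close> is nonzero
    because it contains \<open>H\<close>.\<close>
  have "H \<in> Fbar D"
    using H(2) by (simp add: fg_def)
  then have "\<not> E \<subseteq> {0}"
    using \<open>H \<subseteq> E\<close> by (auto simp: Fbar_def submodule_def)
  then have "E \<in> Fbar D"
    using E by (auto simp: Fbar_def)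
  have "f * q \<noteq> 0"
  proof
    assume "f * q = 0"
    then have "E \<subseteq> {0}"
      unfolding E_def by (intro content_ideal_minimal) (auto simp: submodule_def)
    with \<open>\<not> E \<subseteq> {0}\<close> show False by blast
  qed
  moreover have "star E = star D"
  proof
    show "star E \<subseteq> star D"
      using star \<open>E \<in> Fbar D\<close> \<open>D \<in> Fbar D\<close> ED by (auto simp: semistar_def)
    have "star H \<subseteq> star E"
      using star \<open>E \<in> Fbar D\<close> \<open>H \<in> Fbar D\<close> \<open>H \<subseteq> E\<close> unfolding semistar_def by blast
    with H(1) have "1 \<in> star E" by blast
    have sE: "star E \<in> Fbar D" "star (star E) = star E"
      using star \<open>E \<in> Fbar D\<close> by (auto simp: semistar_def)
    \<comment> \<open>A \<open>D\<close>-module containing 1 contains \<open>D\<close>; idempotence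
      of \<open>star\<close> then gives the remaining inclusion.\<close>
    have "D \<subseteq> star E"
    proof
      fix d assume "d \<in> D"
      with sE(1) \<open>1 \<in> star E\<close> have "d * 1 \<in> star E"
        unfolding Fbar_def submodule_def by blast
      then show "d \<in> star E" by simp
    qed
    then have "star D \<subseteq> star (star E)"
      using star \<open>D \<in> Fbar D\<close> sE(1) unfolding semistar_def by blast
    with sE(2) show "star D \<subseteq> star E" by simp
  qed
  ultimately show ?thesis
    using that[of q] qG fq by (simp add: E_def F_def G_def)
qed

section \<open>Contraction: intersecting overrings of the Nagata ring with \<open>K\<close>\<close>

lemma to_fract_polys_over_cap_K:
  assumes N: "is_subring \<T>" and X: "to_fract [:0, 1:] \<in> \<T>"
    and "f \<in> polys_over (cap_K \<T>)"
  shows "to_fract f \<in> \<T>"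
  using assms(3)
proof (induction f)
  case 0
  show ?case using subring_0[OF N] by simp
next
  case (pCons a p)
  have "p \<in> polys_over (cap_K \<T>)" "a \<in> cap_K \<T>"
    using polys_over_coeff[OF pCons.prems, of "Suc _"] polys_over_coeff[OF pCons.prems, of 0]
    by (auto simp: polys_over_def)
  moreover have "to_fract (pCons a p) = to_fract [:a:] + to_fract [:0, 1:] * to_fract p"
    unfolding to_fract_mult[symmetric] to_fract_add[symmetric] by simp
  ultimately show ?case
    using pCons.IH X by (auto simp: cap_K_def intro!: subring_add[OF N] subring_mult[OF N])
qed

lemma cap_K_subring:
  assumes N: "is_subring \<T>"
  shows "is_subring (cap_K \<T>)"
  unfolding is_subring_def
proof (intro conjI ballI)
  show "1 \<in> cap_K \<T>"
    using subring_1[OF N] by (simp add: cap_K_def flip: one_pCons)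
next
  fix x y assume "x \<in> cap_K \<T>" "y \<in> cap_K \<T>"
  then have xy: "to_fract [:x:] \<in> \<T>" "to_fract [:y:] \<in> \<T>"
    by (auto simp: cap_K_def)
  have "to_fract [:x - y:] = to_fract [:x:] - to_fract [:y:]"
    unfolding to_fract_diff[symmetric] by simp
  then show "x - y \<in> cap_K \<T>"
    using subring_diff[OF N xy] by (simp add: cap_K_def)
  have "to_fract [:x * y:] = to_fract [:x:] * to_fract [:y:]"
    unfolding to_fract_mult[symmetric] by (simp add: mult.commute)
  then show "x * y \<in> cap_K \<T>"
    using subring_mult[OF N xy] by (simp add: cap_K_def)
qed

text \<open>For linkedness, write \<open>F\<close> as the content of some \<open>g\<close>. Then
  \<open>1/g\<close> lies in \<open>Na D star\<close>, so if \<open>xg\<close> is over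
  \<open>cap_K \<T>\<close>, the constant \<open>x = (xg)/g\<close> lies in
  \<open>\<T>\<close>.\<close>

lemma overring_Na_cap_K:
  assumes D: "is_subring D" and K: "quot_field D = UNIV" and NT: "overring (Na D star) \<T>"
  shows overring_cap_K: "overring D (cap_K \<T>)"
    and polys_over_cap_K: "f \<in> polys_over (cap_K \<T>) \<Longrightarrow> to_fract f \<in> \<T>"
    and linked_cap_K: "linked D star (cap_K \<T>) (t_op (cap_K \<T>))"
proof -
  have N: "is_subring \<T>" and "Na D star \<subseteq> \<T>"
    using NT by (auto simp: overring_def)
  have DX: "to_fract f \<in> \<T>" if "f \<in> polys_over D" for f
    using that polys_over_subset_Na[OF D, of star] \<open>Na D star \<subseteq> \<T>\<close> by blast
  have "D \<subseteq> cap_K \<T>"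
    using polys_over_const[OF D] DX by (auto simp: cap_K_def)
  note T = cap_K_subring[OF N]
  show over: "overring D (cap_K \<T>)"
    using T \<open>D \<subseteq> cap_K \<T>\<close> K by (simp add: overring_def)
  have "[:0, 1:] \<in> polys_over D"
    using subring_0[OF D] subring_1[OF D]
    by (auto simp: polys_over_def coeff_pCons split: nat.split)
  then have X: "to_fract [:0, 1:] \<in> \<T>" by (rule DX)
  show poly: "to_fract f \<in> \<T>" if "f \<in> polys_over (cap_K \<T>)" for f
    by (rule to_fract_polys_over_cap_K[OF N X that])
  show "linked D star (cap_K \<T>) (t_op (cap_K \<T>))"
    unfolding linked_def
  proof (intro ballI impI)
    fix F assume F: "F \<in> fg D" "F \<subseteq> D" "star F = star D"
    obtain g where g: "g \<noteq> 0" "content_ideal D g = F"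
      using ex_poly_content[OF F(1)] by blast
    have gD: "g \<in> polys_over D"
      using F(2) g(2) content_ideal_coeff[of g _ D] by (auto simp: polys_over_def)
    have "to_fract 1 / to_fract g \<in> Na D star"
      unfolding Na_def using gD g F(3) polys_over_1[OF D] by blast
    then have inv: "to_fract 1 / to_fract g \<in> \<T>"
      using \<open>Na D star \<subseteq> \<T>\<close> by blast
    have gT: "g \<in> polys_over (cap_K \<T>)"
      using gD polys_over_mono[OF \<open>D \<subseteq> cap_K \<T>\<close>] by blast
    have "primitive_over (cap_K \<T>) g"
      unfolding primitive_over_def
    proof (intro conjI allI impI)
      fix x assume "smult x g \<in> polys_over (cap_K \<T>)"
      then have "to_fract (smult x g) * (to_fract 1 / to_fract g) \<in> \<T>"
        by (intro subring_mult[OF N] poly inv)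
      also have "smult x g = [:x:] * g" by simp
      also have "to_fract ([:x:] * g) * (to_fract 1 / to_fract g) = to_fract [:x:]"
        using g(1) unfolding to_fract_mult by simp
      finally show "x \<in> cap_K \<T>" by (simp add: cap_K_def)
    qed (use g gT in auto)
    then show "t_op (cap_K \<T>) (mod_prod F (cap_K \<T>)) = t_op (cap_K \<T>) (cap_K \<T>)"
      unfolding g(2)[symmetric] mod_prod_content_ideal[OF T \<open>D \<subseteq> cap_K \<T>\<close>]
      using t_op_content_eq_iff_primitive[OF T gT g(1)] by blast
  qed
qed

lemma Na_t_op_cap_K:
  assumes D: "is_subring D" and K: "quot_field D = UNIV"
    and star: "semistar D star" and P: "PsMD D star" and NT: "overring (Na D star) \<T>"
  shows "Na (cap_K \<T>) (t_op (cap_K \<T>)) = \<T>"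
proof -
  define T where "T = cap_K \<T>"
  have N: "is_subring \<T>" and sub: "Na D star \<subseteq> \<T>"
    using NT by (auto simp: overring_def)
  have over: "overring D T" and linked: "linked D star T (t_op T)"
    and poly: "\<And>f. f \<in> polys_over T \<Longrightarrow> to_fract f \<in> \<T>"
    using overring_cap_K[OF D K NT] linked_cap_K[OF D K NT] polys_over_cap_K[OF D K NT]
    by (auto simp: T_def)
  have T: "is_subring T" and DT: "D \<subseteq> T"
    using over by (auto simp: overring_def)
  have unit: "to_fract 1 / to_fract h \<in> \<T>"
    if "h \<in> polys_over D" "h \<noteq> 0" "star (content_ideal D h) = star D" for h
    using that sub polys_over_1[OF D] unfolding Na_def by blast
  have "x \<in> \<T>" if x: "x \<in> Na T (t_op T)" for x
  proof -
    obtain f g where fg: "f \<in> polys_over T" "primitive_over T g" "x = to_fract f / to_fract g"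
      using x unfolding Na_t_op[OF T] by blast
    have g0: "g \<noteq> 0"
      using fg(2) by (simp add: primitive_over_def)
    obtain q where q: "\<And>i. coeff q i \<in> colon D (content_ideal D g)"
      "g * q \<in> polys_over D" "g * q \<noteq> 0" "star (content_ideal D (g * q)) = star D"
      using PsMD_inverse_content[OF D star P g0] by blast
    have "g * q \<in> polys_over T"
      using q(2) polys_over_mono[OF DT] by blast
    \<comment> \<open>A priori \<open>q\<close> is only over \<open>K\<close>; Gauss' lemma for the
      primitive \<open>g\<close> brings it over \<open>T\<close>.\<close>
    then have "q \<in> polys_over T"
      by (rule gauss_primitive[OF T fg(2)])
    then have "to_fract (f * q) * (to_fract 1 / to_fract (g * q)) \<in> \<T>"
      by (intro subring_mult[OF N] poly polys_over_mult[OF T] fg(1) unit q)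
    also have "to_fract (f * q) * (to_fract 1 / to_fract (g * q)) = x"
      using q(3) by (simp add: fg(3))
    finally show ?thesis .
  qed
  moreover have "x \<in> Na T (t_op T)" if x: "x \<in> \<T>" for x
  proof -
    obtain f g where fg: "x = to_fract f / to_fract g" "g \<noteq> 0"
      by (cases x) (auto simp: Fract_conv_to_fract)
    obtain q where q: "g * q \<in> polys_over D" "g * q \<noteq> 0"
      "star (content_ideal D (g * q)) = star D"
      using PsMD_inverse_content[OF D star P fg(2)] by blast
    define h where "h = f * q"
    have xh: "x = to_fract h / to_fract (g * q)"
      using q(2) by (simp add: fg(1) h_def)
    have "to_fract (g * q) \<in> \<T>"
      using q(1) sub polys_over_subset_Na[OF D, of star] by blast
    then have "x * to_fract (g * q) \<in> \<T>"
      by (intro subring_mult[OF N] x)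
    then have hT: "to_fract h \<in> \<T>"
      using q(2) by (simp add: xh)
    have "h \<in> polys_over T"
    proof (cases "h = 0")
      case True
      then show ?thesis using subring_0[OF T] by (simp add: polys_over_def)
    next
      case False
      obtain p where p: "\<And>i. coeff p i \<in> colon D (content_ideal D h)"
        "h * p \<in> polys_over D" "h * p \<noteq> 0" "star (content_ideal D (h * p)) = star D"
        using PsMD_inverse_content[OF D star P False] by blast
      have "coeff h i \<in> T" for i
      proof -
        \<comment> \<open>The coefficients of \<open>p\<close> multiply all of \<open>c(h)\<close>
          into \<open>D\<close>, in particular \<open>coeff h i\<close>.\<close>
        have "smult (coeff h i) p \<in> polys_over D"
          using p(1) content_ideal_coeff[of h i D]
          by (auto simp: polys_over_def colon_def mult.commute)
        then have "to_fract (smult (coeff h i) p) \<in> \<T>"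
          using sub polys_over_subset_Na[OF D, of star] by blast
        then have "to_fract h * (to_fract ([:coeff h i:] * p) * (to_fract 1 / to_fract (h * p))) \<in> \<T>"
          by (intro subring_mult[OF N] hT unit p) simp
        also have "to_fract h * (to_fract ([:coeff h i:] * p) * (to_fract 1 / to_fract (h * p))) =
            to_fract [:coeff h i:]"
          using p(3) unfolding to_fract_mult by simp
        finally show ?thesis by (simp add: T_def cap_K_def)
      qed
      then show ?thesis by (simp add: polys_over_def)
    qed
    moreover have "primitive_over T (g * q)"
      by (rule linked_primitive[OF T DT D linked q])
    ultimately show ?thesis
      unfolding Na_t_op[OF T] using xh by blast
  qed
  ultimately show ?thesis unfolding T_def by blast
qed

section \<open>The bijection\<close>

lemma bij_with_inverseI:
  assumes "\<And>x. x \<in> A \<Longrightarrow> f x \<in> B" "\<And>y. y \<in> B \<Longrightarrow> g y \<in> A"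
    and "\<And>x. x \<in> A \<Longrightarrow> g (f x) = x" "\<And>y. y \<in> B \<Longrightarrow> f (g y) = y"
  shows "bij_with_inverse f g A B"
  unfolding bij_with_inverse_def
  using assms bij_betw_byWitness[of A g f B] by blast

lemma Na_bij:
  assumes D: "is_subring D" and K: "quot_field D = UNIV"
    and star: "semistar D star" and P: "PsMD D star"
  shows "bij_with_inverse (\<lambda>T. Na T (t_op T)) cap_K
    {T. overring D T \<and> linked D star T (t_op T)} {\<T>. overring (Na D star) \<T>}"
proof (rule bij_with_inverseI)
  fix T assume "T \<in> {T. overring D T \<and> linked D star T (t_op T)}"
  then have T: "overring D T" "linked D star T (t_op T)" by auto
  show "Na T (t_op T) \<in> {\<T>. overring (Na D star) \<T>}"
    using Na_t_op_overring[OF D K T] by simp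
  show "cap_K (Na T (t_op T)) = T"
    using T(1) by (intro cap_K_Na_t_op) (simp add: overring_def)
next
  fix \<T> assume "\<T> \<in> {\<T>. overring (Na D star) \<T>}"
  then have NT: "overring (Na D star) \<T>" by simp
  show "cap_K \<T> \<in> {T. overring D T \<and> linked D star T (t_op T)}"
    using overring_cap_K[OF D K NT] linked_cap_K[OF D K NT] by simp
  show "Na (cap_K \<T>) (t_op (cap_K \<T>)) = \<T>"
    by (rule Na_t_op_cap_K[OF assms NT])
qed

theorem theorem3p4:
  fixes D R :: "'a::field set" and star :: "'a set \<Rightarrow> 'a set"
  shows
    "(is_subring D \<and> quot_field D = UNIV \<and> semistar D star \<and> PsMD D star \<longrightarrow>
        bij_with_inverse (\<lambda>T. Na T (t_op T)) cap_K
          {T. overring D T \<and> linked D star T (t_op T)}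
          {\<T>. overring (Na D star) \<T>}) \<and>
     (is_subring R \<and> quot_field R = UNIV \<and> PvMD R \<longrightarrow>
        bij_with_inverse (\<lambda>T. Na T (t_op T)) cap_K
          {T. overring R T \<and> linked R (t_op R) T (t_op T)}
          {\<T>. overring (Na R (t_op R)) \<T>})"
proof (intro conjI impI; elim conjE)
  assume "is_subring D" "quot_field D = UNIV" "semistar D star" "PsMD D star"
  then show "bij_with_inverse (\<lambda>T. Na T (t_op T)) cap_K
      {T. overring D T \<and> linked D star T (t_op T)} {\<T>. overring (Na D star) \<T>}"
    by (rule Na_bij)
next
  assume R: "is_subring R" "quot_field R = UNIV" and "PvMD R"
  have t_R: "t_op R R = v_op R R"
    using t_op_self[OF R(1)] v_op_self[OF R(1)] by simp
  \<comment> \<open>Linkedness and the Nagata ring evaluate the operation on \<open>R\<close> only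
    at finitely generated modules and at \<open>R\<close> itself, where \<open>t\<close> and
    \<open>v\<close> agree; so the general result for \<open>v_op R\<close> carries over.\<close>
  have "linked R (t_op R) T (t_op T) \<longleftrightarrow> linked R (v_op R) T (t_op T)" for T
    by (simp add: linked_def t_op_fg t_R)
  moreover have "Na R (t_op R) = Na R (v_op R)"
    by (simp add: Na_def t_op_fg content_ideal_fg t_R cong: conj_cong)
  moreover have "bij_with_inverse (\<lambda>T. Na T (t_op T)) cap_K
      {T. overring R T \<and> linked R (v_op R) T (t_op T)} {\<T>. overring (Na R (v_op R)) \<T>}"
    using R v_op_semistar[OF R(1)] \<open>PvMD R\<close> unfolding PvMD_def by (rule Na_bij)
  ultimately show "bij_with_inverse (\<lambda>T. Na T (t_op T)) cap_K
      {T. overring R T \<and> linked R (t_op R) T (t_op T)} {\<T>. overring (Na R (t_op R)) \<T>}"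
    by simp
qed

end
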